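(* Let $n, N \geq 2$ be integers with $N$ odd, and let $s$ be the multiplicative order of $2$ modulo $N$. Assume $2^n \equiv 1 \pmod s$ (so $s$ is odd). Let $l$ be the largest integer such that $2^l < s$, and let $b$ be the integer with $0 \leq b < s$ and $2^{l+1} \equiv b \pmod s$. Let $a$ be the multiplicative order of $2$ modulo $s$. Set $$k_l = 1 + \sum_{j=0}^{l} 2^{2^j}, \qquad k_b = \sum_{j=0}^{a-1} 2^{b\cdot 2^j}, \qquad d = \gcd(k_b, N),$$ and assume that $d \mid k_l$. For integers $m \geq 0$ let $$I_{n,m} = 1 + \sum_{j=0}^{m} 2^{2^{n+j}}.$$ Then $N \mid I_{n,m}$ for infinitely many positive integers $m$. In fact, there exists a positive integer $r$ with $k_l + r k_b \equiv 0 \pmod N$, and for every such positive integer $r$ one has $$I_{n,m} \equiv 0 \pmod N \quad \text{for } m = l + r a + i L D, \quad i = 0, 1, 2, \ldots,$$ where $L = \operatorname{lcm}(N, a)$ and $D = \gcd(a, N)$.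
   Context: The multiplicative order of $2$ modulo an odd integer $M$ (called in the paper the exponent to which $2$ belongs modulo $M$) is the least positive integer $x$ with $2^x \equiv 1 \pmod M$. *)

theory Defs
  imports "HOL-Number_Theory.Number_Theory"
begin

definition I_num :: "nat \<Rightarrow> nat \<Rightarrow> nat" where
  "I_num n m = 1 + (\<Sum>j=0..m. 2 ^ (2 ^ (n + j)))"

end

theory Submission
  imports Defs
begin

text \<open>
  Modulo \<open>N\<close>, a power \<open>2 ^ e\<close> depends only on \<open>e\<close> modulo \<open>s\<close>, and the powers of two that occur as
  exponents are, modulo \<open>s\<close>, periodic with period \<open>a\<close>. So the terms \<open>2 ^ 2 ^ (n + j)\<close> form a periodic
  sequence modulo \<open>N\<close>. The assumption \<open>2 ^ n \<equiv> 1 (mod s)\<close> removes the shift by \<open>n\<close>: the terms with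
  \<open>j \<le> l\<close>, together with the leading 1, contribute \<open>k\<^sub>l\<close>, and by \<open>2 ^ (l + 1) \<equiv> b (mod s)\<close> each
  subsequent block of \<open>a\<close> terms contributes \<open>k\<^sub>b\<close>. Hence
  \<open>I_num n (l + q * a) \<equiv> k\<^sub>l + q * k\<^sub>b (mod N)\<close>, which is \<open>I_num_cong_linear\<close> below.

  What remains is the linear congruence \<open>k\<^sub>l + r * k\<^sub>b \<equiv> 0 (mod N)\<close>. It is solvable because
  \<open>gcd k\<^sub>b N\<close> divides \<open>k\<^sub>l\<close>, and its solutions are stable under \<open>r \<mapsto> r + i * N\<close>. Since
  \<open>lcm N a * gcd a N = N * a\<close>, adding \<open>i * N\<close> to the number of blocks is the same as adding \<open>i * L * D\<close>
  to the index \<open>m\<close>.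
\<close>

lemma two_power_cong_if_exponents_cong:
  fixes N x y :: nat
  assumes "odd N" and "[x = y] (mod ord N 2)"
  shows "[2 ^ x = 2 ^ y] (mod N)"
  using assms order_divides_expdiff[of N 2 x y] by (simp add: coprime_commute)

text \<open>
  Induction on the number \<open>q\<close> of blocks. For \<open>q = 0\<close> only the shift by \<open>n\<close> has to be removed. The
  exponent of the term at position \<open>t\<close> in the block numbered \<open>q\<close> factors as
  \<open>2 ^ n * 2 ^ (q * a) * 2 ^ (l + 1) * 2 ^ t\<close>, where modulo \<open>s\<close> the first two factors are 1 and the
  third is \<open>b\<close>.
\<close>

lemma I_num_cong_linear:
  fixes n N s l b a q :: nat
  assumes "odd N" and s: "s = ord N 2" and n: "[2 ^ n = 1] (mod s)"
    and b: "[2 ^ (l + 1) = b] (mod s)" and a: "a = ord s 2"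
  shows "[I_num n (l + q * a)
           = (1 + (\<Sum>j=0..l. 2 ^ 2 ^ j)) + q * (\<Sum>j=0..<a. 2 ^ (b * 2 ^ j))] (mod N)"
proof (induction q)
  case 0
  have "[2 ^ 2 ^ (n + j) = 2 ^ 2 ^ j] (mod N)" for j
    using cong_mult[OF n cong_refl[of "2 ^ j"]]
    by (intro two_power_cong_if_exponents_cong[OF \<open>odd N\<close>]) (simp add: power_add s)
  then show ?case
    unfolding I_num_def mult_0 add_0_right by (intro cong_add cong_sum cong_refl)
next
  case (Suc q)
  have "[2 ^ a = 1] (mod s)"
    using a ord[of 2 s] by simp
  then have period: "[2 ^ (q * a) = 1] (mod s)"
    using cong_pow[of "2 ^ a" 1 s q] by (simp add: power_mult mult.commute)
  have term_cong: "[2 ^ 2 ^ (n + (t + Suc (l + q * a))) = 2 ^ (b * 2 ^ t)] (mod N)" for t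
  proof (rule two_power_cong_if_exponents_cong[OF \<open>odd N\<close>])
    have "[2 ^ n * (2 ^ (q * a) * (2 ^ (l + 1) * 2 ^ t)) = 1 * (1 * (b * 2 ^ t))] (mod s)"
      by (intro cong_mult n period b cong_refl)
    then show "[2 ^ (n + (t + Suc (l + q * a))) = b * 2 ^ t] (mod ord N 2)"
      by (simp add: s power_add mult_ac)
  qed
  have "I_num n (l + Suc q * a)
      = 1 + (\<Sum>j=0..<Suc (l + q * a) + a. 2 ^ 2 ^ (n + j))"
    unfolding I_num_def by (simp only: atLeastLessThanSuc_atLeastAtMost[symmetric])
      (simp add: algebra_simps)
  also have "\<dots> = I_num n (l + q * a) + (\<Sum>j=Suc (l + q * a)..<Suc (l + q * a) + a. 2 ^ 2 ^ (n + j))"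
    unfolding I_num_def atLeastLessThanSuc_atLeastAtMost[symmetric]
    by (simp only: sum.atLeastLessThan_concat[symmetric, of 0 "Suc (l + q * a)" "Suc (l + q * a) + a"]
        zero_le le_add1 add.assoc)
  also have "(\<Sum>j=Suc (l + q * a)..<Suc (l + q * a) + a. 2 ^ 2 ^ (n + j))
      = (\<Sum>t=0..<a. 2 ^ 2 ^ (n + (t + Suc (l + q * a))) :: nat)"
    using sum.shift_bounds_nat_ivl[of "\<lambda>j. 2 ^ 2 ^ (n + j)" 0 "Suc (l + q * a)" a]
    by (simp add: add_ac)
  finally have split: "I_num n (l + Suc q * a)
      = I_num n (l + q * a) + (\<Sum>t=0..<a. 2 ^ 2 ^ (n + (t + Suc (l + q * a))))" .
  have "[I_num n (l + q * a) + (\<Sum>t=0..<a. 2 ^ 2 ^ (n + (t + Suc (l + q * a))))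
      = ((1 + (\<Sum>j=0..l. 2 ^ 2 ^ j)) + q * (\<Sum>j=0..<a. 2 ^ (b * 2 ^ j)))
        + (\<Sum>j=0..<a. 2 ^ (b * 2 ^ j))] (mod N)"
    by (intro cong_add[OF Suc.IH] cong_sum term_cong)
  then show ?case
    unfolding split by (simp add: algebra_simps)
qed

lemma linear_cong_zero_solvable:
  fixes k c N :: nat
  assumes "N > 0" and "k > 0" and "gcd k N dvd c"
  shows "\<exists>r>0. [c + r * k = 0] (mod N)"
proof -
  obtain x where x: "[k * x = gcd k N] (mod N)"
    using cong_solve_nat \<open>k > 0\<close> by blast
  obtain e where e: "c = gcd k N * e"
    using assms(3) by (elim dvdE)
  \<comment> \<open>The factor \<open>N - 1\<close> serves as \<open>-1\<close> in the natural numbers; the summand \<open>N\<close> makes the solution positive.\<close>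
  let ?r = "x * e * (N - 1) + N"
  have "[c + (k * x) * (e * (N - 1)) + N * k = c + gcd k N * (e * (N - 1)) + 0] (mod N)"
    by (intro cong_add cong_mult x cong_refl) (simp add: cong_0_iff)
  also have "c + gcd k N * (e * (N - 1)) + 0 = c * N"
    using \<open>N > 0\<close> e by (cases N) (simp_all add: algebra_simps)
  also have "[c * N = 0] (mod N)"
    by (simp add: cong_0_iff)
  finally have "[c + ?r * k = 0] (mod N)"
    by (simp add: algebra_simps)
  moreover have "?r > 0"
    using \<open>N > 0\<close> by simp
  ultimately show ?thesis by blast
qed

theorem theorem1:
  fixes n N s l b a k\<^sub>l k\<^sub>b d L D :: nat
  assumes "n \<ge> 2" and "N \<ge> 2" and "odd N"
    and "s = ord N 2"
    and "[2 ^ n = 1] (mod s)"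
    and "2 ^ l < s" and "\<And>l'. 2 ^ l' < s \<Longrightarrow> l' \<le> l"
    and "b < s" and "[2 ^ (l + 1) = b] (mod s)"
    and "a = ord s 2"
    and "k\<^sub>l = 1 + (\<Sum>j=0..l. 2 ^ (2 ^ j))"
    and "k\<^sub>b = (\<Sum>j=0..<a. 2 ^ (b * 2 ^ j))"
    and "d = gcd k\<^sub>b N"
    and "d dvd k\<^sub>l"
    and "L = lcm N a"
    and "D = gcd a N"
  shows "infinite {m. m > 0 \<and> N dvd I_num n m}
    \<and> (\<exists>r::nat. r > 0 \<and> [k\<^sub>l + r * k\<^sub>b = 0] (mod N))
    \<and> (\<forall>r::nat. r > 0 \<and> [k\<^sub>l + r * k\<^sub>b = 0] (mod N) \<longrightarrow>
          (\<forall>i::nat. [I_num n (l + r * a + i * L * D) = 0] (mod N)))"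
proof -
  have "s > 0"
    using \<open>2 ^ l < s\<close> by simp
  have "coprime s 2"
  proof -
    have "coprime s (2 ^ n)"
      using \<open>[2 ^ n = 1] (mod s)\<close> by (metis cong_imp_coprime cong_sym coprime_1_left coprime_commute)
    then show ?thesis
      using \<open>n \<ge> 2\<close> by simp
  qed
  then have "a > 0"
    using \<open>a = ord s 2\<close> by simp
  then have "k\<^sub>b > 0"
    unfolding \<open>k\<^sub>b = _\<close> by (intro sum_pos) auto
  have step: "L * D = N * a"
    using \<open>L = _\<close> \<open>D = _\<close> by (simp add: gcd.commute lcm_mult_gcd)
  have exists: "\<exists>r>0. [k\<^sub>l + r * k\<^sub>b = 0] (mod N)"
    using linear_cong_zero_solvable[of N k\<^sub>b k\<^sub>l] \<open>N \<ge> 2\<close> \<open>k\<^sub>b > 0\<close> \<open>d = _\<close> \<open>d dvd k\<^sub>l\<close> by simp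
  have zero: "[I_num n (l + r * a + i * L * D) = 0] (mod N)"
    if r: "[k\<^sub>l + r * k\<^sub>b = 0] (mod N)" for r i
  proof -
    have "l + r * a + i * L * D = l + (r + i * N) * a"
      using step by (simp add: algebra_simps)
    then have "[I_num n (l + r * a + i * L * D) = k\<^sub>l + (r + i * N) * k\<^sub>b] (mod N)"
      using I_num_cong_linear[OF \<open>odd N\<close> \<open>s = _\<close> \<open>[2 ^ n = 1] (mod s)\<close>
          \<open>[2 ^ (l + 1) = b] (mod s)\<close> \<open>a = _\<close>, of "r + i * N"]
      unfolding \<open>k\<^sub>l = _\<close> \<open>k\<^sub>b = _\<close> by (simp only:)
    also have "k\<^sub>l + (r + i * N) * k\<^sub>b = (k\<^sub>l + r * k\<^sub>b) + i * k\<^sub>b * N"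
      by (simp add: algebra_simps)
    also have "[\<dots> = 0 + 0] (mod N)"
      by (intro cong_add r) (simp add: cong_0_iff)
    finally show ?thesis by simp
  qed
  obtain r where r: "r > 0" "[k\<^sub>l + r * k\<^sub>b = 0] (mod N)"
    using exists by blast
  have "inj (\<lambda>i. l + r * a + i * L * D)"
    using step \<open>N \<ge> 2\<close> \<open>a > 0\<close> by (auto intro!: injI simp: mult.assoc)
  then have "infinite (range (\<lambda>i. l + r * a + i * L * D))"
    by (rule range_inj_infinite)
  moreover have "range (\<lambda>i. l + r * a + i * L * D) \<subseteq> {m. m > 0 \<and> N dvd I_num n m}"
    using zero[OF r(2)] r(1) \<open>a > 0\<close> by (auto simp: cong_0_iff)
  ultimately have "infinite {m. m > 0 \<and> N dvd I_num n m}"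
    using infinite_super by blast
  then show ?thesis
    using exists zero by blast
qed

end
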